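(* Let $e,k,j$ be integers with $\frac e2<k<e-3$, $2\le j\le\frac k2$, $j+k\le e-1$ and $e+j-2<2k$. Then $0<\frac{k-j}{e-2}<1$, so there exists an integer $n\ge 1$ (depending on $k,j,e$) such that $$\frac{n-1}{n}\le\frac{k-j}{e-2}<\frac{n}{n+1}.$$ For this $n$, the numerical semigroup $S^e_k(j)$ is symmetric if and only if $n(k-j)=(n-1)(e-2)$.
   Context: $S^e_k(j)=\langle e,e+1,\ldots,e+j-1,\,e+j+k,\ldots,2e-1\rangle$ is the numerical semigroup of multiplicity $e$ and width $e-1$ obtained by deleting the $k$ consecutive generators $e+j,\ldots,e+j+k-1$ from $[e,2e-1]$. A numerical semigroup with genus $g$ (number of gaps) and Frobenius number $F$ (largest gap) is symmetric iff $2g=F+1$. *)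

theory Defs
  imports Complex_Main
begin

definition numerical_semigroup :: "nat set \<Rightarrow> bool" where
  "numerical_semigroup S \<longleftrightarrow>
     0 \<in> S \<and> (\<forall>x\<in>S. \<forall>y\<in>S. x + y \<in> S) \<and> finite (UNIV - S)"

inductive_set semigroup_gen :: "nat set \<Rightarrow> nat set" for A :: "nat set" where
  zero: "0 \<in> semigroup_gen A"
| gen: "a \<in> A \<Longrightarrow> a \<in> semigroup_gen A"
| add: "x \<in> semigroup_gen A \<Longrightarrow> y \<in> semigroup_gen A \<Longrightarrow> x + y \<in> semigroup_gen A"

definition gaps :: "nat set \<Rightarrow> nat set" where
  "gaps S = UNIV - S"

definition genus :: "nat set \<Rightarrow> nat" where
  "genus S = card (gaps S)"

(* The semigroup of all natural numbers has no gaps; its Frobenius number is -1 by convention. *)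
definition frobenius :: "nat set \<Rightarrow> int" where
  "frobenius S = (if gaps S = {} then - 1 else int (Max (gaps S)))"

definition symmetric_semigroup :: "nat set \<Rightarrow> bool" where
  "symmetric_semigroup S \<longleftrightarrow> numerical_semigroup S \<and> 2 * int (genus S) = frobenius S + 1"

(* The parameters are integers so that the interval bounds are not affected by truncated
   subtraction; for e, j, k \<ge> 0 all listed generators are nonnegative and nat is injective
   on them. *)
definition S_semigroup :: "int \<Rightarrow> int \<Rightarrow> int \<Rightarrow> nat set" where
  "S_semigroup e k j = semigroup_gen (nat ` ({e..e + j - 1} \<union> {e + j + k..2 * e - 1}))"

lemma semigroup_gen_mult:
  assumes "a \<in> semigroup_gen A"
  shows "m * a \<in> semigroup_gen A"
  by (induction m) (auto intro: semigroup_gen.zero semigroup_gen.add assms)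

lemma numerical_semigroup_S_semigroup:
  assumes "1 \<le> e" and "2 \<le> j"
  shows "numerical_semigroup (S_semigroup e k j)"
proof -
  let ?G = "nat ` ({e..e + j - 1} \<union> {e + j + k..2 * e - 1})"
  define d where "d = nat e"
  have d: "d \<ge> 1" using assms by (simp add: d_def)
  have "nat e \<in> ?G" "nat (e + 1) \<in> ?G" using assms by auto
  moreover have "nat (e + 1) = d + 1" using assms by (simp add: d_def nat_add_distrib)
  ultimately have g: "d \<in> semigroup_gen ?G" "d + 1 \<in> semigroup_gen ?G"
    by (auto simp: d_def intro: semigroup_gen.gen)
  have big: "x \<in> semigroup_gen ?G" if x: "d * d \<le> x" for x
  proof -
    have r: "x mod d < d" using d by simp
    have "d \<le> x div d" using div_le_mono[OF x, of d] d by simp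
    then have q: "x mod d \<le> x div d" using r by linarith
    have "(x div d - x mod d) * d + (x mod d) * (d + 1)
        = ((x div d - x mod d) + x mod d) * d + x mod d"
      by (simp only: distrib_left distrib_right mult_1_right add.assoc)
    also have "\<dots> = x" using q by simp
    finally show ?thesis
      using semigroup_gen.add[OF semigroup_gen_mult[OF g(1)] semigroup_gen_mult[OF g(2)],
          of "x div d - x mod d" "x mod d"] by simp
  qed
  have "UNIV - semigroup_gen ?G \<subseteq> {..<d * d}"
    using big by (meson Diff_iff lessThan_iff not_le_imp_less subsetI)
  then have "finite (UNIV - semigroup_gen ?G)"
    by (rule finite_subset) simp
  then show ?thesis
    by (auto simp: numerical_semigroup_def S_semigroup_def
        intro: semigroup_gen.zero semigroup_gen.add)
qed

end

theory Submission
  imports Defs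
begin

text \<open>
  Put \<open>m = e - j - k\<close>. The large generators are the numbers \<open>2e - t\<close> with \<open>1 \<le> t \<le> m\<close>, so it is
  natural to give them weight 2 and the small generators \<open>e + t\<close>, \<open>0 \<le> t \<le> j - 1\<close>, weight 1.
  The sums of total weight \<open>w\<close> then fill a whole interval around \<open>w e\<close>,
  namely \<open>[w e - \<lfloor>w/2\<rfloor> m, w (e + j - 1)]\<close> (\<open>S_semigroup_iff_in_block\<close>): replacing two small
  generators by one large one moves the attainable range down without ever leaving a hole.
  Both ends increase with \<open>w\<close>, so the gaps of the semigroup are exactly the holes between
  consecutive blocks, and genus and Frobenius number can be read off from the hole lengths
  (\<open>symmetric_iff_sum_holes\<close>).

  The hole after block \<open>w\<close> has length \<open>e - 1 - \<lfloor>(w+1)/2\<rfloor> m - w (j - 1)\<close>, which decreases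
  with \<open>w\<close>. With \<open>D = m + 2 (j - 1) = (e - 2) - (k - j)\<close> the hole after block \<open>2p\<close> has length
  \<open>e - 1 - p D\<close>. The inequalities that determine \<open>n\<close> say \<open>n D \<le> e - 2 < (n + 1) D\<close>, that is, the
  hole after block \<open>2n\<close> is nonempty and the one after block \<open>2n + 2\<close> is empty. Two cases remain.

  If the hole after block \<open>2n\<close> is the last one, summing the lengths gives
  \<open>2 g - (F + 1) = (2n + 1) (e - 2 - n D)\<close>, which vanishes iff \<open>n D = e - 2\<close>, a rewriting of
  \<open>n (k - j) = (n - 1) (e - 2)\<close>. If the hole after block \<open>2n + 1\<close> is still nonempty, then
  \<open>2 g - (F + 1) = (n + 1) (2 (e - 2) - (2n + 1) D)\<close>. Nonemptiness of that hole amounts to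
  \<open>e - 2 \<ge> (n + 1) D - (j - 1)\<close>; since \<open>D > 2 (j - 1)\<close> this makes the difference positive and forces
  \<open>n D < e - 2\<close>, so both sides of the equivalence fail.
\<close>

section \<open>Semigroups that are unions of a chain of blocks\<close>

text \<open>
  The reason that only holes between neighbouring blocks matter: an element that lies to the right of
  block \<open>w\<close> and to the left of block \<open>w + 1\<close> is, by monotonicity of the two ends, outside
  every other block as well.
\<close>

lemma gaps_eq_holes:
  fixes L R :: "nat \<Rightarrow> int"
  assumes blocks: "\<And>x. x \<in> S \<longleftrightarrow> (\<exists>w. L w \<le> int x \<and> int x \<le> R w)"
    and "mono L" and "strict_mono R" and "L 0 = 0" and "R 0 = 0"
  shows "int ` gaps S = (\<Union>w. {R w<..<L (Suc w)})"
proof (intro equalityI subsetI)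
  fix y assume "y \<in> int ` gaps S"
  then obtain x where x: "y = int x" "x \<notin> S" by (auto simp: gaps_def)
  have grow: "int w \<le> R w" for w
  proof (induction w)
    case (Suc w)
    then show ?case using strict_monoD[OF \<open>strict_mono R\<close>, of w "Suc w"] by simp
  qed (simp add: \<open>R 0 = 0\<close>)
  define v where "v = (LEAST v. int x \<le> R v)"
  have v: "int x \<le> R v" unfolding v_def by (rule LeastI) (rule grow)
  have "v \<noteq> 0"
  proof
    assume "v = 0"
    then have "x = 0" using v \<open>R 0 = 0\<close> by simp
    then show False using x(2) blocks[of 0] \<open>L 0 = 0\<close> \<open>R 0 = 0\<close> by (metis of_nat_0 order_refl)
  qed
  then obtain w where w: "v = Suc w" by (cases v) auto
  have "R w < int x" using not_less_Least[of w "\<lambda>v. int x \<le> R v"] w v_def by force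
  moreover have "int x < L (Suc w)" using v x(2) blocks[of x] w by force
  ultimately show "y \<in> (\<Union>w. {R w<..<L (Suc w)})" using x(1) by auto
next
  fix y assume "y \<in> (\<Union>w. {R w<..<L (Suc w)})"
  then obtain w where w: "R w < y" "y < L (Suc w)" by auto
  have "0 \<le> R w" using \<open>strict_mono R\<close> \<open>R 0 = 0\<close> by (metis le0 strict_mono_less_eq)
  then have y: "y = int (nat y)" using w by simp
  have "nat y \<notin> S"
  proof
    assume "nat y \<in> S"
    then obtain v where v: "L v \<le> y" "y \<le> R v" using blocks[of "nat y"] y by auto
    have "w < v" using w(1) v(2) \<open>strict_mono R\<close> by (meson le_less_trans less_le_trans strict_mono_less)
    then have "L (Suc w) \<le> L v" using \<open>mono L\<close> by (simp add: monoD)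
    then show False using v w by simp
  qed
  then show "y \<in> int ` gaps S" using y by (metis DiffI UNIV_I gaps_def image_eqI)
qed

text \<open>
  If \<open>W\<close> is the last block followed by a nonempty hole, that hole ends with the Frobenius number
  \<open>L (W + 1) - 1\<close>, and the genus is the total length of the holes, so that
  \<open>2 g = F + 1\<close> becomes an equation between a sum and an endpoint.
\<close>

lemma symmetric_iff_sum_holes:
  fixes L R :: "nat \<Rightarrow> int"
  assumes "numerical_semigroup S"
    and blocks: "\<And>x. x \<in> S \<longleftrightarrow> (\<exists>w. L w \<le> int x \<and> int x \<le> R w)"
    and "mono L" and "strict_mono R" and "L 0 = 0" and "R 0 = 0"
    and nonempty_block: "\<And>w. L w \<le> R w"
    and last_hole: "\<And>w. R w + 1 < L (Suc w) \<longleftrightarrow> w \<le> W"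
  shows "symmetric_semigroup S \<longleftrightarrow> 2 * (\<Sum>w\<le>W. L (Suc w) - R w - 1) = L (Suc W)"
proof -
  let ?H = "\<lambda>w. {R w<..<L (Suc w)}"
  have empty: "?H w = {}" if "\<not> w \<le> W" for w
    using last_hole[of w] that by auto
  have gaps: "int ` gaps S = (\<Union>w\<le>W. ?H w)"
    unfolding gaps_eq_holes[OF blocks assms(3-6)] using empty by blast
  have less_disjoint: "?H v \<inter> ?H w = {}" if "v < w" for v w
  proof -
    have "L (Suc v) \<le> R (Suc v)" by (rule nonempty_block)
    also have "\<dots> \<le> R w" using that \<open>strict_mono R\<close> by (simp add: strict_mono_less_eq)
    finally show ?thesis by auto
  qed
  have disjoint: "?H v \<inter> ?H w = {}" if "v \<noteq> w" for v w
    using that less_disjoint[of v w] less_disjoint[of w v] by (metis Int_commute linorder_neqE_nat)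
  have "genus S = card (int ` gaps S)"
    unfolding genus_def by (simp add: card_image)
  also have "\<dots> = (\<Sum>w\<le>W. card (?H w))"
    unfolding gaps
    by (intro card_UN_disjoint ballI impI disjoint) auto
  finally have "int (genus S) = (\<Sum>w\<le>W. int (card (?H w)))" by simp
  also have "\<dots> = (\<Sum>w\<le>W. L (Suc w) - R w - 1)"
  proof (intro sum.cong refl)
    fix w assume "w \<in> {..W}"
    then show "int (card (?H w)) = L (Suc w) - R w - 1"
      using last_hole[of w] by simp
  qed
  finally have genus: "int (genus S) = (\<Sum>w\<le>W. L (Suc w) - R w - 1)" .
  have "L (Suc W) - 1 \<in> ?H W" using last_hole[of W] by simp
  then have "L (Suc W) - 1 \<in> int ` gaps S" unfolding gaps by blast
  then obtain f where f: "f \<in> gaps S" "int f = L (Suc W) - 1" by auto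
  have "x \<le> f" if "x \<in> gaps S" for x
  proof -
    have "int x \<in> (\<Union>w\<le>W. ?H w)" using that gaps by blast
    then obtain w where "w \<le> W" "int x < L (Suc w)" by auto
    moreover have "L (Suc w) \<le> L (Suc W)" using \<open>w \<le> W\<close> \<open>mono L\<close> by (simp add: monoD)
    ultimately show ?thesis using f(2) by linarith
  qed
  moreover have "finite (gaps S)"
    using \<open>numerical_semigroup S\<close> by (simp add: numerical_semigroup_def gaps_def)
  ultimately have "Max (gaps S) = f" using f(1) by (intro Max_eqI)
  then have "frobenius S = L (Suc W) - 1" using f by (auto simp: frobenius_def)
  then show ?thesis
    using \<open>numerical_semigroup S\<close> genus by (simp add: symmetric_semigroup_def)
qed

section \<open>The blocks of the semigroup\<close>

definition block_left :: "int \<Rightarrow> int \<Rightarrow> nat \<Rightarrow> int" where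
  "block_left e m w = int w * e - int (w div 2) * m"

definition block_right :: "int \<Rightarrow> int \<Rightarrow> nat \<Rightarrow> int" where
  "block_right e j w = int w * (e + j - 1)"

lemma block_left_Suc_ge:
  assumes "0 \<le> m" "m \<le> e"
  shows "block_left e m w \<le> block_left e m (Suc w)"
proof -
  have "Suc w div 2 = w div 2 \<or> Suc w div 2 = Suc (w div 2)" by linarith
  then show ?thesis using assms by (auto simp: block_left_def algebra_simps)
qed

lemma block_left_add_ge:
  assumes "0 \<le> m"
  shows "block_left e m (v + w) \<le> block_left e m v + block_left e m w"
proof -
  have "int (v div 2 + w div 2) * m \<le> int ((v + w) div 2) * m"
    using assms by (intro mult_right_mono) auto
  then show ?thesis by (simp add: block_left_def algebra_simps)
qed

lemma block_left_le_multiple: "0 \<le> m \<Longrightarrow> block_left e m w \<le> int w * e"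
  by (simp add: block_left_def)

lemma multiple_le_block_right: "1 \<le> j \<Longrightarrow> int w * e \<le> block_right e j w"
  unfolding block_right_def by (intro mult_left_mono) auto

text \<open>
  Every member of block \<open>w\<close> is reached greedily. To the right of \<open>w e\<close>, removing the small generator
  that takes away as much of the excess as possible lands in block \<open>w - 1\<close>, not to the left
  of its centre. To the left of \<open>w e\<close>, removing the large generator that reduces the deficit as
  much as possible lands in block \<open>w - 2\<close>, not to the right of its centre.
\<close>

lemma block_subset_S_semigroup:
  assumes m: "m = e - j - k" "1 \<le> m" and "1 \<le> j" "0 \<le> k"
    and "block_left e m w \<le> int x" "int x \<le> block_right e j w"
  shows "x \<in> S_semigroup e k j"
  using assms(5,6)
proof (induction w arbitrary: x rule: less_induct)
  case (less w)
  have small: "nat (e + t) \<in> S_semigroup e k j" if "0 \<le> t" "t \<le> j - 1" for t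
    unfolding S_semigroup_def using that by (intro semigroup_gen.gen imageI) auto
  have large: "nat (2 * e - t) \<in> S_semigroup e k j" if "1 \<le> t" "t \<le> m" for t
    unfolding S_semigroup_def using that m by (intro semigroup_gen.gen imageI) auto
  have step: "x \<in> S_semigroup e k j"
    if "nat a \<in> S_semigroup e k j" "v < w" "0 \<le> a" "a \<le> int x"
      "block_left e m v \<le> int x - a" "int x - a \<le> block_right e j v" for a v
  proof -
    have "nat (int x - a) \<in> S_semigroup e k j" using that by (intro less.IH[of v]) auto
    then have "nat a + nat (int x - a) \<in> S_semigroup e k j"
      using that(1) unfolding S_semigroup_def by (intro semigroup_gen.add)
    moreover have "nat a + nat (int x - a) = x" using that by linarith
    ultimately show ?thesis by simp
  qed
  have e: "1 \<le> e" using assms(1-4) by simp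
  show ?case
  proof (cases "w = 0")
    case True
    then have "x = 0" using less.prems by (simp add: block_left_def block_right_def)
    then show ?thesis by (simp add: S_semigroup_def semigroup_gen.zero)
  next
    case w: False
    show ?thesis
    proof (cases "int w * e \<le> int x")
      case True
      define t where "t = min (j - 1) (int x - int w * e)"
      obtain v where v: "w = Suc v" using w by (cases w) auto
      have t: "0 \<le> t" "t \<le> j - 1" "t \<le> int x - int w * e"
        using True \<open>1 \<le> j\<close> by (auto simp: t_def)
      have x: "int v * e \<le> int x - (e + t)" using t(3) v by (simp add: algebra_simps)
      have "0 \<le> int v * e" using e by simp
      then have "e + t \<le> int x" using x by linarith
      moreover have "block_left e m v \<le> int x - (e + t)"
        using x block_left_le_multiple[of m e v] m by linarith
      moreover have "int x - (e + t) \<le> block_right e j v"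
        using less.prems(2) multiple_le_block_right[OF \<open>1 \<le> j\<close>, of v e] v t_def
        by (auto simp: min_def block_right_def algebra_simps)
      ultimately show ?thesis using x t small e v by (intro step[of "e + t" v]) auto
    next
      case False
      have "w \<noteq> 1" using False less.prems(1) by (auto simp: block_left_def)
      then obtain v where v: "w = Suc (Suc v)" using w by (metis One_nat_def not0_implies_Suc)
      define t where "t = min m (int w * e - int x)"
      have t: "1 \<le> t" "t \<le> m" using False m by (auto simp: t_def)
      have left: "block_left e m v \<le> int x - (2 * e - t)"
        using less.prems(1) block_left_le_multiple[of m e v] v m t_def
        by (auto simp: min_def block_left_def algebra_simps)
      have "int x - (2 * e - t) \<le> int v * e" using v t_def by (simp add: algebra_simps)
      then have right: "int x - (2 * e - t) \<le> block_right e j v"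
        using multiple_le_block_right[OF \<open>1 \<le> j\<close>, of v e] by linarith
      have "int (v div 2) * m \<le> int v * e"
        using m e assms(3,4) by (intro mult_mono) auto
      then have "0 \<le> block_left e m v" by (simp add: block_left_def)
      then show ?thesis
        using left right t large e v m assms(3,4) by (intro step[of "2 * e - t" v]) auto
    qed
  qed
qed

text \<open>
  Conversely, the small generators are block 1, the large ones lie in block 2, and the weights
  of blocks add up because \<open>\<lfloor>v/2\<rfloor> + \<lfloor>w/2\<rfloor> \<le> \<lfloor>(v+w)/2\<rfloor>\<close>.
\<close>

lemma S_semigroup_iff_in_block:
  assumes m: "m = e - j - k" "1 \<le> m" and "1 \<le> j" "0 \<le> k"
  shows "x \<in> S_semigroup e k j \<longleftrightarrow>
    (\<exists>w. block_left e m w \<le> int x \<and> int x \<le> block_right e j w)"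
proof
  assume "x \<in> S_semigroup e k j"
  then show "\<exists>w. block_left e m w \<le> int x \<and> int x \<le> block_right e j w"
    unfolding S_semigroup_def
  proof induction
    case zero
    show ?case by (rule exI[of _ 0]) (simp add: block_left_def block_right_def)
  next
    case (gen a)
    then obtain b where b: "a = nat b" "b \<in> {e..e + j - 1} \<union> {e + j + k..2 * e - 1}" by blast
    then have a: "int a = b" using assms by auto
    show ?case
    proof (cases "b \<le> e + j - 1")
      case True
      then show ?thesis using a b(2) assms
        by (intro exI[of _ 1]) (auto simp: block_left_def block_right_def)
    next
      case False
      then show ?thesis using a b(2) assms
        by (intro exI[of _ 2]) (auto simp: block_left_def block_right_def)
    qed
  next
    case (add x y)
    then obtain v w where vw: "block_left e m v \<le> int x" "int x \<le> block_right e j v"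
      "block_left e m w \<le> int y" "int y \<le> block_right e j w" by blast
    have "block_right e j (v + w) = block_right e j v + block_right e j w"
      by (simp add: block_right_def algebra_simps)
    then show ?case using vw block_left_add_ge[of m e v w] m
      by (intro exI[of _ "v + w"]) auto
  qed
qed (blast intro: block_subset_S_semigroup[OF assms])

section \<open>Summing the holes\<close>

text \<open>
  A value \<open>\<le> 0\<close> means that block \<open>w + 1\<close> adjoins or overlaps block \<open>w\<close>.
\<close>

definition hole_length :: "int \<Rightarrow> int \<Rightarrow> int \<Rightarrow> nat \<Rightarrow> int" where
  "hole_length e m j w = e - 1 - int (Suc w div 2) * m - int w * (j - 1)"

lemma hole_length_eq: "block_left e m (Suc w) - block_right e j w - 1 = hole_length e m j w"
  by (simp add: block_left_def block_right_def hole_length_def algebra_simps)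

lemma hole_length_antimono:
  assumes "0 \<le> m" "1 \<le> j" "v \<le> w"
  shows "hole_length e m j w \<le> hole_length e m j v"
proof -
  have "int (Suc v div 2) * m \<le> int (Suc w div 2) * m"
    using assms by (intro mult_right_mono) (auto simp: div_le_mono)
  moreover have "int v * (j - 1) \<le> int w * (j - 1)"
    using assms by (intro mult_right_mono) auto
  ultimately show ?thesis by (simp add: hole_length_def)
qed

lemma hole_length_even: "hole_length e m j (2 * p) = e - 1 - int p * (m + 2 * (j - 1))"
  by (simp add: hole_length_def algebra_simps)

lemma hole_length_odd:
  "hole_length e m j (Suc (2 * p)) = e - 1 - int (Suc p) * (m + 2 * (j - 1)) + (j - 1)"
  by (simp add: hole_length_def algebra_simps)

lemma sum_hole_length_even:
  "(\<Sum>w\<le>2 * p. hole_length e m j w)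
     = (2 * int p + 1) * (e - 1) - int p * (int p + 1) * m - int p * (2 * int p + 1) * (j - 1)"
proof (induction p)
  case 0
  show ?case by (simp add: hole_length_def)
next
  case (Suc p)
  have "(\<Sum>w\<le>2 * Suc p. hole_length e m j w)
      = (\<Sum>w\<le>2 * p. hole_length e m j w) + hole_length e m j (Suc (2 * p))
        + hole_length e m j (2 * Suc p)" by simp
  then show ?case unfolding Suc.IH hole_length_even hole_length_odd
    by (simp add: algebra_simps)
qed

lemma symmetric_iff_of_last_hole:
  assumes m: "m = e - j - k" "1 \<le> m" and "2 \<le> j" "0 \<le> k"
    and pos: "0 < hole_length e m j W" and nonpos: "hole_length e m j (Suc W) \<le> 0"
  shows "symmetric_semigroup (S_semigroup e k j) \<longleftrightarrow>
    2 * (\<Sum>w\<le>W. hole_length e m j w) = block_left e m (Suc W)"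
proof -
  have last_hole: "block_right e j w + 1 < block_left e m (Suc w) \<longleftrightarrow> w \<le> W" for w
  proof -
    have "0 < hole_length e m j w \<longleftrightarrow> w \<le> W"
    proof (cases "w \<le> W")
      case True
      then show ?thesis using hole_length_antimono[of m j w W e] pos assms by simp
    next
      case False
      then show ?thesis using hole_length_antimono[of m j "Suc W" w e] nonpos assms by simp
    qed
    then show ?thesis using hole_length_eq[of e m w j] by linarith
  qed
  have "block_left e m w \<le> block_right e j w" for w
    using block_left_le_multiple[of m e w] multiple_le_block_right[of j w e] assms by linarith
  moreover have "mono (block_left e m)"
    using assms by (intro incseq_SucI block_left_Suc_ge) auto
  moreover have "strict_mono (block_right e j)"
    using assms by (auto simp: strict_mono_def block_right_def)
  ultimately show ?thesis
    using symmetric_iff_sum_holes[OF numerical_semigroup_S_semigroup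
        S_semigroup_iff_in_block[OF m], where W = W] last_hole assms
    by (simp add: hole_length_eq block_left_def[of _ _ 0] block_right_def[of _ _ 0])
qed

section \<open>Symmetry of the semigroup\<close>

text \<open>
  The bounds on \<open>n D\<close> leave only the hole after block \<open>2n + 1\<close> undecided. If it is nonempty,
  \<open>D > 2 (j - 1)\<close> makes the semigroup have strictly more gaps than symmetry allows.
\<close>

lemma symmetric_S_semigroup_iff:
  assumes m: "m = e - j - k" "1 \<le> m" and "2 \<le> j" "0 \<le> k"
    and D: "D = m + 2 * (j - 1)"
    and n: "int n * D \<le> e - 2" "e - 2 < (int n + 1) * D"
  shows "symmetric_semigroup (S_semigroup e k j) \<longleftrightarrow> int n * D = e - 2"
proof -
  have even: "0 < hole_length e m j (2 * n)" "hole_length e m j (2 * Suc n) \<le> 0"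
    using n unfolding hole_length_even D by (simp_all add: algebra_simps)
  show ?thesis
  proof (cases "hole_length e m j (Suc (2 * n)) \<le> 0")
    case True
    have "2 * (\<Sum>w\<le>2 * n. hole_length e m j w) - block_left e m (Suc (2 * n))
        = (2 * int n + 1) * (e - 2 - int n * D)"
      unfolding sum_hole_length_even block_left_def D by (simp add: algebra_simps)
    moreover have "2 * int n + 1 \<noteq> 0" by simp
    ultimately show ?thesis
      using symmetric_iff_of_last_hole[OF assms(1-4) even(1) True]
      by (metis diff_eq_diff_eq diff_self mult_eq_0_iff right_minus_eq)
  next
    case False
    have difference: "2 * (\<Sum>w\<le>Suc (2 * n). hole_length e m j w) - block_left e m (Suc (Suc (2 * n)))
        = (int n + 1) * (2 * (e - 2) - (2 * int n + 1) * D)"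
      unfolding sum.atMost_Suc sum_hole_length_even hole_length_odd block_left_def D
      by (simp add: algebra_simps)
    have odd: "(int n + 1) * D \<le> e - 2 + (j - 1)"
      using False unfolding hole_length_odd D by (simp add: algebra_simps)
    define P where "P = int n * D"
    have expand: "(int n + 1) * D = P + D" "(2 * int n + 1) * D = 2 * P + D"
      by (simp_all add: P_def algebra_simps)
    have "2 * (j - 1) < D" using D assms(2) by simp
    then have "P < e - 2" using odd assms(3) unfolding expand by presburger
    then have "int n * D < e - 2" unfolding P_def .
    have "0 < 2 * (e - 2) - (2 * int n + 1) * D"
      using odd \<open>2 * (j - 1) < D\<close> unfolding expand by presburger
    then have "(int n + 1) * (2 * (e - 2) - (2 * int n + 1) * D) \<noteq> 0" by simp
    then have "2 * (\<Sum>w\<le>Suc (2 * n). hole_length e m j w) \<noteq> block_left e m (Suc (Suc (2 * n)))"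
      using difference by linarith
    moreover have "hole_length e m j (Suc (Suc (2 * n))) \<le> 0" using even(2) by simp
    ultimately show ?thesis
      using symmetric_iff_of_last_hole[OF assms(1-4), of "Suc (2 * n)"] False
        \<open>int n * D < e - 2\<close> by linarith
  qed
qed

theorem theorem4p5:
  fixes e k j :: int
  assumes "real_of_int e / 2 < real_of_int k" and "k < e - 3"
    and "2 \<le> j" and "real_of_int j \<le> real_of_int k / 2"
    and "j + k \<le> e - 1"
    and "e + j - 2 < 2 * k"
  shows "0 < real_of_int (k - j) / real_of_int (e - 2)
       \<and> real_of_int (k - j) / real_of_int (e - 2) < 1
       \<and> (\<exists>n::int. n \<ge> 1
            \<and> real_of_int (n - 1) / real_of_int n \<le> real_of_int (k - j) / real_of_int (e - 2)
            \<and> real_of_int (k - j) / real_of_int (e - 2) < real_of_int n / real_of_int (n + 1))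
       \<and> (\<forall>n::int. n \<ge> 1
            \<and> real_of_int (n - 1) / real_of_int n \<le> real_of_int (k - j) / real_of_int (e - 2)
            \<and> real_of_int (k - j) / real_of_int (e - 2) < real_of_int n / real_of_int (n + 1)
            \<longrightarrow> (symmetric_semigroup (S_semigroup e k j)
                  \<longleftrightarrow> n * (k - j) = (n - 1) * (e - 2)))"
proof -
  have bounds: "0 < k" "j < k" "2 < e" using assms by linarith+
  define m where "m = e - j - k"
  define D where "D = m + 2 * (j - 1)"
  have D: "D = (e - 2) - (k - j)" by (simp add: D_def m_def)
  have "1 \<le> m" using assms(5) by (simp add: m_def)
  have "0 < D" "D \<le> e - 2" using D_def \<open>1 \<le> m\<close> assms(3) D bounds by auto
  have lower: "real_of_int (n - 1) / real_of_int n \<le> real_of_int (k - j) / real_of_int (e - 2)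
      \<longleftrightarrow> n * D \<le> e - 2" if "1 \<le> n" for n
  proof -
    have "real_of_int (n - 1) / real_of_int n \<le> real_of_int (k - j) / real_of_int (e - 2)
        \<longleftrightarrow> real_of_int ((n - 1) * (e - 2)) \<le> real_of_int ((k - j) * n)"
      using that bounds by (simp add: divide_le_eq pos_le_divide_eq mult.commute frac_le_eq field_simps)
    also have "\<dots> \<longleftrightarrow> n * D \<le> e - 2" unfolding of_int_le_iff D by (simp add: algebra_simps)
    finally show ?thesis .
  qed
  have upper: "real_of_int (k - j) / real_of_int (e - 2) < real_of_int n / real_of_int (n + 1)
      \<longleftrightarrow> e - 2 < (n + 1) * D" if "1 \<le> n" for n
  proof -
    have "real_of_int (k - j) / real_of_int (e - 2) < real_of_int n / real_of_int (n + 1)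
        \<longleftrightarrow> real_of_int ((k - j) * (n + 1)) < real_of_int (n * (e - 2))"
      using that bounds by (simp add: field_simps)
    also have "\<dots> \<longleftrightarrow> e - 2 < (n + 1) * D" unfolding of_int_less_iff D by (simp add: algebra_simps)
    finally show ?thesis .
  qed
  have "\<exists>n\<ge>1. n * D \<le> e - 2 \<and> e - 2 < (n + 1) * D"
  proof (intro exI conjI)
    show "1 \<le> (e - 2) div D"
      using \<open>0 < D\<close> \<open>D \<le> e - 2\<close> by (simp add: pos_imp_zdiv_pos_iff int_one_le_iff_zero_less)
    show "(e - 2) div D * D \<le> e - 2"
      using pos_mod_sign[OF \<open>0 < D\<close>, of "e - 2"] div_mult_mod_eq[of "e - 2" D] by linarith
    show "e - 2 < ((e - 2) div D + 1) * D"
      using pos_mod_bound[OF \<open>0 < D\<close>, of "e - 2"] div_mult_mod_eq[of "e - 2" D]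
      unfolding distrib_right by linarith
  qed
  moreover have "symmetric_semigroup (S_semigroup e k j) \<longleftrightarrow> n * (k - j) = (n - 1) * (e - 2)"
    if "1 \<le> n" "n * D \<le> e - 2" "e - 2 < (n + 1) * D" for n
  proof -
    have "symmetric_semigroup (S_semigroup e k j) \<longleftrightarrow> n * D = e - 2"
      using symmetric_S_semigroup_iff[OF m_def \<open>1 \<le> m\<close> assms(3) _ D_def, of "nat n"] that bounds
      by simp
    also have "\<dots> \<longleftrightarrow> n * (k - j) = (n - 1) * (e - 2)"
      unfolding D by (auto simp: algebra_simps)
    finally show ?thesis .
  qed
  moreover have "0 < real_of_int (k - j) / real_of_int (e - 2)" using bounds by simp
  moreover have "real_of_int (k - j) / real_of_int (e - 2) < 1"
    using \<open>0 < D\<close> D bounds by (simp add: divide_less_eq)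
  ultimately show ?thesis using lower upper by blast
qed

end
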